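(* Consider a piecewise constant probability density function on $[0,1]$: $$f(y)=\lambda_j,\qquad n_{j-1}<y\le n_j,\qquad 1\le j\le m,$$ where $\lambda_1,\ldots,\lambda_m>0$, $0=n_0<n_1<\cdots<n_m=1$, and $\lambda_1<\lambda_2<\ldots<\lambda_m$. Consider the sequence of Markov chains $X_{(d)}$ indexed by $d=1,2,\ldots$ on $\mathbb E_{(d)}=\{0,1\}^d$ with initial distribution $\nu_{(d)}=\delta_{(0,\ldots,0)}$ and transition matrix $$\mathbf P_{(d)}(\mathbf i^{(1)},\mathbf i^{(2)})=\begin{cases} a_kp_k & \text{if } \mathbf i^{(2)}=\mathbf i^{(1)}+\mathbf s_k,\\ 1-\displaystyle\sum_{j:\,i^{(1)}_j=0}a_jp_j-\sum_{j:\,i^{(1)}_j=1}(1-a_j)p_j & \text{if } \mathbf i^{(2)}=\mathbf i^{(1)},\\ (1-a_k)p_k & \text{if } \mathbf i^{(2)}=\mathbf i^{(1)}-\mathbf s_k \end{cases}$$ (all other entries $0$), with $$p_k=\int_{(k-1)/d}^{k/d}f(y)\,dy,\qquad k=1,\ldots,d,$$ and any $a_k\in(0,1)$, $k=1,\ldots,d$. The stationary distribution is $\pi_{(d)}(\mathbf i)=\prod_{j=1}^d[a_j\mathbf 1(i_j=1)+(1-a_j)\mathbf 1(i_j=0)]$. The sequence exhibits a separation cutoff at time $t_d=\frac{d}{\lambda_1}(\log d-\log(n_1))$ with window size $w_d=\frac{d}{\lambda_1}$.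
   Context: $\mathbf i^{(r)}=(i^{(r)}_1,\ldots,i^{(r)}_d)$; $\mathbf s_k=(0,\ldots,0,1,0,\ldots,0)$ with $1$ at position $k$. The density $f$ (i.e. $m$, $\lambda_j$, $n_j$) is fixed, independent of $d$. Separation: $sep(\mu,\pi)=\max_{\mathbf e}(1-\mu(\mathbf e)/\pi(\mathbf e))$. A sequence of ergodic chains $X_{(d)}\sim(\nu_{(d)},\mathbf P_{(d)})$ with stationary distributions $\pi_{(d)}$ exhibits a separation cutoff at time $t_d$ with window size $w_d=o(t_d)$ if $$\lim_{c\to\infty}\limsup_{d\to\infty}sep(\nu_{(d)}\mathbf P_{(d)}^{t_d+cw_d},\pi_{(d)})=0,\qquad \lim_{c\to\infty}\liminf_{d\to\infty}sep(\nu_{(d)}\mathbf P_{(d)}^{t_d-cw_d},\pi_{(d)})=1,$$ where non-integer exponents are replaced by their integer parts (floor), and only large $d$ matter. *)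

theory Defs
  imports "HOL-Analysis.Analysis" "HOL-Library.Landau_Symbols"
begin

text \<open>Distributions and transition matrices on a finite state space \<open>E\<close> are real-valued functions
  of one or two states; only their values on \<open>E\<close> matter.\<close>

definition prob_dist :: "'s set \<Rightarrow> ('s \<Rightarrow> real) \<Rightarrow> bool" where
  "prob_dist E \<mu> \<longleftrightarrow> (\<forall>i\<in>E. 0 \<le> \<mu> i) \<and> (\<Sum>i\<in>E. \<mu> i) = 1"

definition stochastic_matrix :: "'s set \<Rightarrow> ('s \<Rightarrow> 's \<Rightarrow> real) \<Rightarrow> bool" where
  "stochastic_matrix E P \<longleftrightarrow> (\<forall>i\<in>E. prob_dist E (P i))"

fun mat_pow :: "'s set \<Rightarrow> ('s \<Rightarrow> 's \<Rightarrow> real) \<Rightarrow> nat \<Rightarrow> 's \<Rightarrow> 's \<Rightarrow> real" where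
  "mat_pow E P 0 i j = (if i = j then 1 else 0)"
| "mat_pow E P (Suc n) i j = (\<Sum>l\<in>E. mat_pow E P n i l * P l j)"

definition vec_mat :: "'s set \<Rightarrow> ('s \<Rightarrow> real) \<Rightarrow> ('s \<Rightarrow> 's \<Rightarrow> real) \<Rightarrow> 's \<Rightarrow> real" where
  "vec_mat E \<mu> P j = (\<Sum>i\<in>E. \<mu> i * P i j)"

definition irreducible_matrix :: "'s set \<Rightarrow> ('s \<Rightarrow> 's \<Rightarrow> real) \<Rightarrow> bool" where
  "irreducible_matrix E P \<longleftrightarrow> (\<forall>i\<in>E. \<forall>j\<in>E. \<exists>n. 0 < mat_pow E P n i j)"

definition aperiodic_matrix :: "'s set \<Rightarrow> ('s \<Rightarrow> 's \<Rightarrow> real) \<Rightarrow> bool" where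
  "aperiodic_matrix E P \<longleftrightarrow> (\<forall>i\<in>E. Gcd {n. 0 < n \<and> 0 < mat_pow E P n i i} = 1)"

definition ergodic_chain :: "'s set \<Rightarrow> ('s \<Rightarrow> real) \<Rightarrow> ('s \<Rightarrow> 's \<Rightarrow> real) \<Rightarrow> bool" where
  "ergodic_chain E \<nu> P \<longleftrightarrow> finite E \<and> E \<noteq> {} \<and> prob_dist E \<nu> \<and> stochastic_matrix E P
     \<and> irreducible_matrix E P \<and> aperiodic_matrix E P"

definition stationary_dist :: "'s set \<Rightarrow> ('s \<Rightarrow> 's \<Rightarrow> real) \<Rightarrow> ('s \<Rightarrow> real) \<Rightarrow> bool" where
  "stationary_dist E P \<pi> \<longleftrightarrow> prob_dist E \<pi> \<and> (\<forall>j\<in>E. vec_mat E \<pi> P j = \<pi> j)"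

definition sep :: "'s set \<Rightarrow> ('s \<Rightarrow> real) \<Rightarrow> ('s \<Rightarrow> real) \<Rightarrow> real" where
  "sep E \<mu> \<pi> = Max ((\<lambda>e. 1 - \<mu> e / \<pi> e) ` E)"

text \<open>Separation after \<open>\<lfloor>x\<rfloor>\<close> steps. For negative \<open>x\<close> the number of steps is \<open>0\<close>; in a cutoff this
  concerns, for each \<open>c\<close>, only finitely many \<open>d\<close>.\<close>

definition sep_at :: "'s set \<Rightarrow> ('s \<Rightarrow> real) \<Rightarrow> ('s \<Rightarrow> 's \<Rightarrow> real) \<Rightarrow> ('s \<Rightarrow> real) \<Rightarrow> real \<Rightarrow> real" where
  "sep_at E \<nu> P \<pi> x = sep E (vec_mat E \<nu> (mat_pow E P (nat \<lfloor>x\<rfloor>))) \<pi>"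

text \<open>The chains are indexed by \<open>d \<ge> 1\<close>. The limits superior and inferior are taken in the extended
  reals.\<close>

definition separation_cutoff ::
  "(nat \<Rightarrow> 's set) \<Rightarrow> (nat \<Rightarrow> 's \<Rightarrow> real) \<Rightarrow> (nat \<Rightarrow> 's \<Rightarrow> 's \<Rightarrow> real) \<Rightarrow> (nat \<Rightarrow> 's \<Rightarrow> real)
    \<Rightarrow> (nat \<Rightarrow> real) \<Rightarrow> (nat \<Rightarrow> real) \<Rightarrow> bool" where
  "separation_cutoff E \<nu> P \<pi> t w \<longleftrightarrow>
     (\<forall>d\<ge>1. ergodic_chain (E d) (\<nu> d) (P d) \<and> stationary_dist (E d) (P d) (\<pi> d)) \<and>
     w \<in> o(t) \<and>
     ((\<lambda>c::real. limsup (\<lambda>d. ereal (sep_at (E d) (\<nu> d) (P d) (\<pi> d) (t d + c * w d)))) \<longlongrightarrow> 0) at_top \<and>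
     ((\<lambda>c::real. liminf (\<lambda>d. ereal (sep_at (E d) (\<nu> d) (P d) (\<pi> d) (t d - c * w d)))) \<longlongrightarrow> 1) at_top"

text \<open>The cube \<open>{0,1}\<^sup>d\<close>: integer vectors indexed by \<open>1,\<dots>,d\<close>, padded with zeros.\<close>

definition cube :: "nat \<Rightarrow> (nat \<Rightarrow> int) set" where
  "cube d = {i. (\<forall>k\<in>{1..d}. i k \<in> {0, 1}) \<and> (\<forall>k. k \<notin> {1..d} \<longrightarrow> i k = 0)}"

definition unit_vec :: "nat \<Rightarrow> nat \<Rightarrow> int" where
  "unit_vec k l = (if l = k then 1 else 0)"

definition delta_zero :: "(nat \<Rightarrow> int) \<Rightarrow> real" where
  "delta_zero i = (if i = (\<lambda>_. 0) then 1 else 0)"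

text \<open>For \<open>i \<noteq> j\<close> at most one summand below is non-zero, since \<open>j - i\<close> determines \<open>k\<close> and the sign;
  so the sum is the entry \<open>a\<^sub>k p\<^sub>k\<close> if \<open>j = i + s\<^sub>k\<close>, \<open>(1 - a\<^sub>k) p\<^sub>k\<close> if \<open>j = i - s\<^sub>k\<close>, and \<open>0\<close> for all
  other \<open>j\<close>.\<close>

definition cube_matrix ::
  "nat \<Rightarrow> (nat \<Rightarrow> real) \<Rightarrow> (nat \<Rightarrow> real) \<Rightarrow> (nat \<Rightarrow> int) \<Rightarrow> (nat \<Rightarrow> int) \<Rightarrow> real" where
  "cube_matrix d a p i j =
     (if j = i
      then 1 - (\<Sum>k\<in>{k\<in>{1..d}. i k = 0}. a k * p k) - (\<Sum>k\<in>{k\<in>{1..d}. i k = 1}. (1 - a k) * p k)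
      else (\<Sum>k=1..d. if j = (\<lambda>l. i l + unit_vec k l) then a k * p k
                      else if j = (\<lambda>l. i l - unit_vec k l) then (1 - a k) * p k
                      else 0))"

definition cube_product_dist :: "nat \<Rightarrow> (nat \<Rightarrow> real) \<Rightarrow> (nat \<Rightarrow> int) \<Rightarrow> real" where
  "cube_product_dist d a i =
     (\<Prod>k=1..d. a k * (if i k = 1 then 1 else 0) + (1 - a k) * (if i k = 0 then 1 else 0))"

definition density_on :: "real set \<Rightarrow> (real \<Rightarrow> real) \<Rightarrow> bool" where
  "density_on S f \<longleftrightarrow> (\<forall>y\<in>S. 0 \<le> f y) \<and> (f has_integral 1) S"

definition cell_mass :: "(real \<Rightarrow> real) \<Rightarrow> nat \<Rightarrow> nat \<Rightarrow> real" where
  "cell_mass f d k = integral {(real k - 1) / real d .. real k / real d} f"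

end

theory Submission
  imports Defs "HOL-Real_Asymp.Real_Asymp"
begin

text \<open>One step of the chain picks a coordinate \<open>k\<close> with probability \<open>p\<^sub>k\<close> and replaces it by a fresh
  Bernoulli variable with parameter \<open>a\<^sub>k\<close>. Given the set \<open>S\<close> of coordinates picked so far, the picked
  coordinates are therefore independent with their stationary marginals, while the others still
  have their initial values. So the \<open>t\<close>-step transition probabilities are averages of explicit
  product laws over the random set \<open>S\<close> (lemma \<open>mat_pow_eq_expect\<close>), and \<open>S\<close> evolves as in the
  coupon collector problem with unequal probabilities.

  Keeping only the event that every coordinate has been picked gives \<open>P\<^sup>t(j, i) \<ge> \<pi>(i) \<cdot> Prob(S = {1..d})\<close>
  for all \<open>j\<close> and \<open>i\<close>. This yields ergodicity and uniqueness of the stationary distribution. For the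
  start \<open>(0,\<dots>,0)\<close> and the target \<open>(1,\<dots>,1)\<close> it is an equality, because a coordinate that was
  never picked is still \<open>0\<close>. Hence the separation after \<open>t\<close> steps is exactly the probability that
  the collection is not complete at time \<open>t\<close>, whatever the \<open>a\<^sub>k\<close> are (lemma \<open>sep_eq_incomplete\<close>).

  It remains to locate the completion time. Every \<open>p\<^sub>k\<close> is at least \<open>\<lambda>\<^sub>1 / d\<close>, and a union bound over
  the \<open>d\<close> coupons bounds the separation at time \<open>t\<^sub>d + c w\<^sub>d\<close> by \<open>n\<^sub>1 exp(\<lambda>\<^sub>1) exp(-c)\<close>
  (lemma \<open>sep_after_cutoff\<close>). Conversely the first \<open>\<lfloor>n\<^sub>1 d\<rfloor>\<close> coupons have probability exactly
  \<open>\<lambda>\<^sub>1 / d\<close>. At time \<open>t\<^sub>d - c w\<^sub>d\<close> the expected number of them that are missing is of order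
  \<open>n\<^sub>1\<^sup>2 exp(c)\<close>, and the events of missing different coupons are negatively correlated, so by
  Chebyshev's inequality some coupon is missing with probability at least
  \<open>1 - O(exp(-c))\<close> (lemma \<open>sep_before_cutoff\<close>). Shifting \<open>t\<^sub>d\<close> by a fixed multiple of \<open>w\<^sub>d\<close> only
  changes the constants in these bounds; the term \<open>- log n\<^sub>1\<close> is of this kind.\<close>

section \<open>Coupon collection with unequal probabilities\<close>

locale coupons =
  fixes K :: "'k set" and p :: "'k \<Rightarrow> real"
  assumes finite_K: "finite K"
    and p_pos: "k \<in> K \<Longrightarrow> 0 < p k"
    and sum_p: "sum p K = 1"
begin

text \<open>The Markov operator on functions of the collected set, for one more coupon.\<close>

definition draw :: "('k set \<Rightarrow> real) \<Rightarrow> 'k set \<Rightarrow> real" where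
  "draw g S = (\<Sum>k\<in>K. p k * g (insert k S))"

text \<open>\<open>expect t g\<close> is the expectation of \<open>g(S)\<close>, where \<open>S\<close> is the set collected in \<open>t\<close> draws.
  Iterating the operator avoids a probability space of draw sequences: only linearity and
  monotonicity of the expectation matter below.\<close>

definition expect :: "nat \<Rightarrow> ('k set \<Rightarrow> real) \<Rightarrow> real" where
  "expect t g = (draw ^^ t) g {}"

definition collection_prob :: "nat \<Rightarrow> real" where
  "collection_prob t = expect t (\<lambda>S. of_bool (K \<subseteq> S))"

lemma expect_0 [simp]: "expect 0 g = g {}"
  by (simp add: expect_def)

lemma expect_Suc: "expect (Suc t) g = expect t (draw g)"
  by (simp only: expect_def funpow_Suc_right comp_apply)

lemma expect_sum: "expect t (\<lambda>S. \<Sum>x\<in>I. g x S) = (\<Sum>x\<in>I. expect t (g x))"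
proof (induction t arbitrary: g)
  case (Suc t)
  have "draw (\<lambda>S. \<Sum>x\<in>I. g x S) = (\<lambda>S. \<Sum>x\<in>I. draw (g x) S)"
    unfolding draw_def sum_distrib_left by (rule ext, rule sum.swap)
  then show ?case by (simp add: expect_Suc Suc.IH)
qed simp

lemma expect_mult_right: "expect t (\<lambda>S. g S * c) = expect t g * c"
proof (induction t arbitrary: g)
  case (Suc t)
  have "draw (\<lambda>S. g S * c) = (\<lambda>S. draw g S * c)"
    by (rule ext) (simp add: draw_def sum_distrib_right mult.assoc)
  then show ?case by (simp add: expect_Suc Suc.IH)
qed simp

lemma expect_add: "expect t (\<lambda>S. g S + h S) = expect t g + expect t h"
proof (induction t arbitrary: g h)
  case (Suc t)
  have "draw (\<lambda>S. g S + h S) = (\<lambda>S. draw g S + draw h S)"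
    by (rule ext) (simp add: draw_def sum.distrib distrib_left)
  then show ?case by (simp add: expect_Suc Suc.IH)
qed simp

lemma expect_const: "expect t (\<lambda>_. c) = c"
proof (induction t)
  case (Suc t)
  have "draw (\<lambda>_. c) = (\<lambda>_. c)"
    by (rule ext) (simp add: draw_def sum_p flip: sum_distrib_right)
  then show ?case by (simp add: expect_Suc Suc.IH)
qed simp

lemma expect_mono:
  assumes "\<And>S. g S \<le> h S"
  shows "expect t g \<le> expect t h"
  using assms
proof (induction t arbitrary: g h)
  case (Suc t)
  have "draw g S \<le> draw h S" for S
    unfolding draw_def using Suc.prems p_pos by (intro sum_mono mult_left_mono) (auto simp: less_imp_le)
  then show ?case unfolding expect_Suc by (rule Suc.IH)
qed simp

text \<open>The indicator of \<open>A \<inter> S = {}\<close> is an eigenfunction of \<open>draw\<close>: the next coupon keeps a set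
  disjoint from \<open>A\<close> with probability \<open>1 - p(A)\<close>.\<close>

lemma expect_disjoint:
  assumes "A \<subseteq> K"
  shows "expect t (\<lambda>S. of_bool (A \<inter> S = {})) = (1 - sum p A) ^ t"
proof (induction t)
  case (Suc t)
  have "draw (\<lambda>S. of_bool (A \<inter> S = {})) S = of_bool (A \<inter> S = {}) * (1 - sum p A)" for S
  proof -
    have "draw (\<lambda>S. of_bool (A \<inter> S = {})) S
        = of_bool (A \<inter> S = {}) * (\<Sum>k\<in>K. if k \<in> K - A then p k else 0)"
      unfolding draw_def sum_distrib_left by (intro sum.cong) auto
    also have "(\<Sum>k\<in>K. if k \<in> K - A then p k else 0) = sum p (K - A)"
      using finite_K by (subst sum.inter_restrict[symmetric]) (auto intro: arg_cong[where f = "sum p"])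
    also have "\<dots> = 1 - sum p A"
      using sum_diff[OF finite_K assms, of p] sum_p by simp
    finally show ?thesis .
  qed
  then have "draw (\<lambda>S. of_bool (A \<inter> S = {})) = (\<lambda>S. of_bool (A \<inter> S = {}) * (1 - sum p A))"
    by (rule ext)
  then show ?case by (simp add: expect_Suc expect_mult_right Suc.IH)
qed simp

lemma expect_miss: "k \<in> K \<Longrightarrow> expect t (\<lambda>S. of_bool (k \<notin> S)) = (1 - p k) ^ t"
  using expect_disjoint[of "{k}" t] by simp

lemma sum_p_le_1: "A \<subseteq> K \<Longrightarrow> sum p A \<le> 1"
  using sum_mono2[OF finite_K, of A p] sum_p p_pos by (auto simp: less_imp_le)

lemma collection_prob_nonneg: "0 \<le> collection_prob t"
  using expect_mono[of "\<lambda>_. 0" "\<lambda>S. of_bool (K \<subseteq> S)" t] by (simp add: collection_prob_def expect_const)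

text \<open>The union bound over the coupons that may be missing.\<close>

lemma collection_prob_ge: "1 - (\<Sum>k\<in>K. (1 - p k) ^ t) \<le> collection_prob t"
proof -
  have "1 \<le> expect t (\<lambda>S. of_bool (K \<subseteq> S) + (\<Sum>k\<in>K. of_bool (k \<notin> S)))"
  proof -
    have "1 \<le> (of_bool (K \<subseteq> S) + (\<Sum>k\<in>K. of_bool (k \<notin> S)) :: real)" for S
    proof (cases "K \<subseteq> S")
      case False
      then obtain k where "k \<in> K" "k \<notin> S" by auto
      then show ?thesis
        using member_le_sum[of k K "\<lambda>k. of_bool (k \<notin> S) :: real"] finite_K by simp
    qed (simp add: sum_nonneg)
    then show ?thesis using expect_mono[of "\<lambda>_. 1"] by (simp add: expect_const)
  qed
  then show ?thesis
    by (simp add: expect_add expect_sum collection_prob_def expect_miss cong: sum.cong)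
qed

text \<open>The second moment method. Let \<open>X\<close> count the coupons of \<open>A\<close> that are missing; its mean is \<open>\<mu>\<close>.
  Since \<open>1 - p\<^sub>j - p\<^sub>k \<le> (1 - p\<^sub>j)(1 - p\<^sub>k)\<close>, missing \<open>j\<close> and missing \<open>k\<close> are negatively correlated, so the
  variance of \<open>X\<close> is at most \<open>\<mu>\<close>. A complete collection forces \<open>X = 0\<close>, a deviation of \<open>\<mu>\<close> from the mean,
  which has probability at most \<open>\<mu> / \<mu>\<^sup>2\<close>.\<close>

lemma collection_prob_le:
  assumes A: "A \<subseteq> K" and \<mu>: "\<mu> = (\<Sum>k\<in>A. (1 - p k) ^ t)" and pos: "0 < \<mu>"
  shows "collection_prob t \<le> 1 / \<mu>"
proof -
  define X where "X S = (\<Sum>k\<in>A. of_bool (k \<notin> S) :: real)" for S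
  have fin: "finite A" using A finite_K finite_subset by blast
  have E1: "expect t X = \<mu>"
    unfolding X_def \<mu> expect_sum using A by (intro sum.cong) (auto simp: expect_miss)
  have pair: "expect t (\<lambda>S. of_bool (j \<notin> S) * of_bool (k \<notin> S))
      \<le> (1 - p j) ^ t * (1 - p k) ^ t + (if j = k then (1 - p k) ^ t else 0)"
    if "j \<in> A" "k \<in> A" for j k
  proof (cases "j = k")
    case True
    have "p k \<le> 1" using sum_p_le_1[of "{k}"] that A by auto
    then show ?thesis using True expect_miss[of k t] that A
      by (auto simp flip: of_bool_conj)
  next
    case False
    have "(\<lambda>S. of_bool (j \<notin> S) * of_bool (k \<notin> S)) = (\<lambda>S. of_bool ({j, k} \<inter> S = {}) :: real)"
      by auto
    then have "expect t (\<lambda>S. of_bool (j \<notin> S) * of_bool (k \<notin> S)) = (1 - (p j + p k)) ^ t"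
      using expect_disjoint[of "{j, k}" t] that A False by auto
    also have "\<dots> \<le> ((1 - p j) * (1 - p k)) ^ t"
    proof (rule power_mono)
      have "0 < p j * p k" using p_pos that A by (meson mult_pos_pos subsetD)
      then show "1 - (p j + p k) \<le> (1 - p j) * (1 - p k)" by (simp add: algebra_simps)
      show "0 \<le> 1 - (p j + p k)" using sum_p_le_1[of "{j, k}"] that A False by auto
    qed
    finally show ?thesis using False by (simp add: power_mult_distrib)
  qed
  have "expect t (\<lambda>S. X S * X S) =
      (\<Sum>j\<in>A. \<Sum>k\<in>A. expect t (\<lambda>S. of_bool (j \<notin> S) * of_bool (k \<notin> S)))"
    unfolding X_def sum_product expect_sum ..
  also have "\<dots> \<le> (\<Sum>j\<in>A. \<Sum>k\<in>A. (1 - p j) ^ t * (1 - p k) ^ t + (if j = k then (1 - p k) ^ t else 0))"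
    by (intro sum_mono pair)
  also have "\<dots> = \<mu> * \<mu> + \<mu>"
    unfolding \<mu> sum_product sum.distrib using fin by simp
  finally have E2: "expect t (\<lambda>S. X S * X S) \<le> \<mu> * \<mu> + \<mu>" .
  \<comment> \<open>The right-hand side is \<open>(X - \<mu>)\<^sup>2\<close>, in a form to which linearity applies directly.\<close>
  have "of_bool (K \<subseteq> S) * (\<mu> * \<mu>) \<le> (X S * X S + X S * (- 2 * \<mu>)) + \<mu> * \<mu>" for S
  proof (cases "K \<subseteq> S")
    case True
    then have "X S = 0" unfolding X_def using A by (intro sum.neutral) auto
    then show ?thesis by simp
  next
    case False
    have "0 \<le> (X S - \<mu>)\<^sup>2" by simp
    then show ?thesis using False by (simp add: power2_eq_square algebra_simps)
  qed
  from expect_mono[of "\<lambda>S. of_bool (K \<subseteq> S) * (\<mu> * \<mu>)", OF this, of t]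
  have "collection_prob t * (\<mu> * \<mu>) \<le> expect t (\<lambda>S. X S * X S) + \<mu> * (- 2 * \<mu>) + \<mu> * \<mu>"
    unfolding expect_mult_right expect_add expect_const E1 collection_prob_def .
  then have "collection_prob t * \<mu> * \<mu> \<le> 1 * \<mu>" using E2 by (simp add: algebra_simps)
  then have "collection_prob t * \<mu> \<le> 1" using pos by (metis mult_right_le_imp_le)
  then show ?thesis using pos by (simp add: field_simps)
qed

text \<open>The factor \<open>exp q\<close> hidden in \<open>exp (q * (1 - x))\<close> pays for rounding the time \<open>x\<close> down; the bound also
  covers negative \<open>x\<close>, where the number of draws is \<open>0\<close>.\<close>

lemma incomplete_le_exp:
  assumes q: "0 \<le> q" "\<And>k. k \<in> K \<Longrightarrow> q \<le> p k"
  shows "1 - collection_prob (nat \<lfloor>x\<rfloor>) \<le> real (card K) * exp (q * (1 - x))"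
proof -
  let ?t = "nat \<lfloor>x\<rfloor>"
  have "1 - collection_prob ?t \<le> (\<Sum>k\<in>K. (1 - p k) ^ ?t)" using collection_prob_ge[of ?t] by simp
  also have "\<dots> \<le> (\<Sum>k\<in>K. exp (q * (1 - x)))"
  proof (rule sum_mono)
    fix k assume k: "k \<in> K"
    have "(1 - p k) ^ ?t \<le> exp (- q) ^ ?t"
      using q(2)[OF k] sum_p_le_1[of "{k}"] k exp_ge_add_one_self[of "- q"]
      by (intro power_mono) auto
    also have "\<dots> = exp (- q * real ?t)" by (simp add: exp_of_nat_mult[symmetric] mult.commute)
    also have "\<dots> \<le> exp (q * (1 - x))"
    proof -
      have "q * (x - 1) \<le> q * real ?t" using q(1) by (intro mult_left_mono) linarith+
      then show ?thesis by (simp add: algebra_simps)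
    qed
    finally show "(1 - p k) ^ ?t \<le> exp (q * (1 - x))" .
  qed
  finally show ?thesis by simp
qed

text \<open>Here \<open>1 - q \<ge> exp (- q - 2 q\<^sup>2)\<close> turns the expected number \<open>card A * (1 - q) ^ t\<close> of missing coupons into
  an exponential.\<close>

lemma collection_prob_le_exp:
  assumes A: "A \<subseteq> K" "A \<noteq> {}" "\<And>k. k \<in> A \<Longrightarrow> p k = q"
    and q: "0 \<le> q" "q \<le> 1 / 2" and x: "0 \<le> x"
  shows "collection_prob (nat \<lfloor>x\<rfloor>) \<le> exp ((q + 2 * q\<^sup>2) * x) / real (card A)"
proof -
  let ?t = "nat \<lfloor>x\<rfloor>"
  have card: "0 < real (card A)" using A finite_K finite_subset by (fastforce simp: card_gt_0_iff)
  have "exp (- (q + 2 * q\<^sup>2) * x) \<le> exp (- (q + 2 * q\<^sup>2) * real ?t)"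
  proof -
    have "(q + 2 * q\<^sup>2) * real ?t \<le> (q + 2 * q\<^sup>2) * x"
      using q x by (intro mult_left_mono) auto
    then show ?thesis by (simp only: mult_minus_left neg_le_iff_le exp_le_cancel_iff)
  qed
  also have "\<dots> = exp (- (q + 2 * q\<^sup>2)) ^ ?t" by (simp add: exp_of_nat_mult[symmetric] mult.commute)
  also have "\<dots> \<le> (1 - q) ^ ?t"
  proof (intro power_mono)
    have "exp (- (q + 2 * q\<^sup>2)) \<le> exp (ln (1 - q))"
      using ln_one_minus_pos_lower_bound[OF q] by simp
    then show "exp (- (q + 2 * q\<^sup>2)) \<le> 1 - q" using q by simp
  qed simp
  finally have low: "exp (- (q + 2 * q\<^sup>2) * x) \<le> (1 - q) ^ ?t" .
  have "collection_prob ?t \<le> 1 / (real (card A) * (1 - q) ^ ?t)"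
    using A card q by (intro collection_prob_le[of A]) auto
  also have "\<dots> \<le> 1 / (real (card A) * exp (- (q + 2 * q\<^sup>2) * x))"
    using low card by (intro divide_left_mono mult_left_mono mult_pos_pos) (auto intro: less_le_trans[OF _ low])
  also have "\<dots> = exp ((q + 2 * q\<^sup>2) * x) / real (card A)"
    by (simp only: mult_minus_left exp_minus) (simp add: divide_simps)
  finally show ?thesis .
qed

lemma eventually_collected:
  assumes "\<epsilon> > 0"
  shows "eventually (\<lambda>t. 1 - \<epsilon> < collection_prob t) sequentially"
proof -
  have "(\<lambda>t. 1 - (\<Sum>k\<in>K. (1 - p k) ^ t)) \<longlonglongrightarrow> 1 - (\<Sum>k\<in>K. 0)"
  proof (intro tendsto_diff tendsto_const tendsto_sum)
    fix k assume "k \<in> K"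
    then have "0 < p k" "p k \<le> 1" using p_pos sum_p_le_1[of "{k}"] by auto
    then show "(\<lambda>t. (1 - p k) ^ t) \<longlonglongrightarrow> 0" by (intro LIMSEQ_power_zero) auto
  qed
  then have "eventually (\<lambda>t. 1 - \<epsilon> < 1 - (\<Sum>k\<in>K. (1 - p k) ^ t)) sequentially"
    using assms by (intro order_tendstoD(1)) auto
  then show ?thesis by eventually_elim (rule less_le_trans[OF _ collection_prob_ge])
qed

end

section \<open>The coordinate-refreshment walk on the cube\<close>

lemma finite_cube: "finite (cube d)"
proof -
  have "cube d \<subseteq> {i. \<forall>k. (k \<in> {1..d} \<longrightarrow> i k \<in> {0, 1}) \<and> (k \<notin> {1..d} \<longrightarrow> i k = 0)}"
    by (auto simp: cube_def)
  then show ?thesis by (rule finite_subset) (intro finite_set_of_finite_funs; simp)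
qed

lemma zero_in_cube: "(\<lambda>_. 0) \<in> cube d"
  by (simp add: cube_def)

lemma cube_upd: "i \<in> cube d \<Longrightarrow> k \<in> {1..d} \<Longrightarrow> v \<in> {0, 1} \<Longrightarrow> i(k := v) \<in> cube d"
  by (auto simp: cube_def)

locale refreshment = coupons "{1..d}" p for d :: nat and p :: "nat \<Rightarrow> real" +
  fixes a :: "nat \<Rightarrow> real"
  assumes a_range: "k \<in> {1..d} \<Longrightarrow> 0 < a k \<and> a k < 1"
begin

definition marginal :: "nat \<Rightarrow> int \<Rightarrow> real" where
  "marginal k v = a k * (if v = 1 then 1 else 0) + (1 - a k) * (if v = 0 then 1 else 0)"

text \<open>The law of the walk started at \<open>j\<close>, given that \<open>S\<close> is the set of refreshed coordinates.\<close>

definition law :: "(nat \<Rightarrow> int) \<Rightarrow> nat set \<Rightarrow> (nat \<Rightarrow> int) \<Rightarrow> real" where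
  "law j S i = (\<Prod>k=1..d. if k \<in> S then marginal k (i k) else of_bool (i k = j k))"

text \<open>The transition matrix of refreshing coordinate \<open>k\<close>.\<close>

definition refresh :: "nat \<Rightarrow> (nat \<Rightarrow> int) \<Rightarrow> (nat \<Rightarrow> int) \<Rightarrow> real" where
  "refresh k l i = marginal k (i k) * of_bool (\<forall>r. r \<noteq> k \<longrightarrow> l r = i r)"

abbreviation "P \<equiv> cube_matrix d a p"
abbreviation "\<pi> \<equiv> cube_product_dist d a"

lemma marginal_nonneg: "k \<in> {1..d} \<Longrightarrow> 0 \<le> marginal k v"
  using a_range[of k] by (auto simp: marginal_def)

lemma law_nonneg: "0 \<le> law j S i"
  unfolding law_def by (intro prod_nonneg) (auto intro: marginal_nonneg)

lemma law_full: "{1..d} \<subseteq> S \<Longrightarrow> law j S i = \<pi> i"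
  unfolding law_def cube_product_dist_def by (intro prod.cong) (auto simp: marginal_def)

lemma product_dist_pos:
  assumes "i \<in> cube d"
  shows "0 < \<pi> i"
  unfolding cube_product_dist_def
proof (intro prod_pos)
  fix k assume "k \<in> {1..d}"
  then show "0 < a k * (if i k = 1 then 1 else 0) + (1 - a k) * (if i k = 0 then 1 else 0)"
    using assms a_range[of k] by (auto simp: cube_def)
qed

text \<open>The diagonal entries agree because a refreshment leaves coordinate \<open>k\<close> at \<open>0\<close> with probability
  \<open>1 - a\<^sub>k\<close> and at \<open>1\<close> with probability \<open>a\<^sub>k\<close>, and the \<open>p\<^sub>k\<close> sum to \<open>1\<close>.\<close>

lemma cube_matrix_eq_refresh:
  assumes l: "l \<in> cube d" and i: "i \<in> cube d"
  shows "P l i = (\<Sum>k=1..d. p k * refresh k l i)"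
proof (cases "i = l")
  case True
  have "P l i = (\<Sum>k=1..d. p k) - (\<Sum>k=1..d. if l k = 0 then a k * p k else 0)
      - (\<Sum>k=1..d. if l k = 1 then (1 - a k) * p k else 0)"
    unfolding cube_matrix_def sum_p using True
    by (simp flip: sum.inter_filter)
  also have "\<dots> = (\<Sum>k=1..d. p k - (if l k = 0 then a k * p k else 0)
      - (if l k = 1 then (1 - a k) * p k else 0))"
    by (simp add: sum_subtractf)
  also have "\<dots> = (\<Sum>k=1..d. p k * refresh k l i)"
  proof (intro sum.cong refl)
    fix k assume "k \<in> {1..d}"
    then have "l k = 0 \<or> l k = 1" using l by (auto simp: cube_def)
    then show "p k - (if l k = 0 then a k * p k else 0) - (if l k = 1 then (1 - a k) * p k else 0)
        = p k * refresh k l i"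
      unfolding refresh_def marginal_def using True by (auto simp: algebra_simps)
  qed
  finally show ?thesis .
next
  case False
  have "(if i = (\<lambda>r. l r + unit_vec k r) then a k * p k
         else if i = (\<lambda>r. l r - unit_vec k r) then (1 - a k) * p k else 0) = p k * refresh k l i"
    if k: "k \<in> {1..d}" for k
  proof (cases "\<forall>r. r \<noteq> k \<longrightarrow> l r = i r")
    case True
    then have "l k \<noteq> i k" using False by (metis ext)
    moreover have "l k = 0 \<or> l k = 1" "i k = 0 \<or> i k = 1" using l i k by (auto simp: cube_def)
    ultimately consider "l k = 0" "i k = 1" | "l k = 1" "i k = 0" by auto
    then show ?thesis
    proof cases
      case 1
      then have "i = (\<lambda>r. l r + unit_vec k r)" using True by (auto simp: unit_vec_def)
      then show ?thesis using 1 True unfolding refresh_def marginal_def by simp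
    next
      case 2
      then have "i = (\<lambda>r. l r - unit_vec k r)" using True by (auto simp: unit_vec_def)
      moreover have "i \<noteq> (\<lambda>r. l r + unit_vec k r)"
      proof
        assume "i = (\<lambda>r. l r + unit_vec k r)"
        then have "i k = l k + unit_vec k k" by (rule fun_cong)
        then show False using 2 by (simp add: unit_vec_def)
      qed
      ultimately show ?thesis using 2 True unfolding refresh_def marginal_def by simp
    qed
  next
    case off: False
    then have "i \<noteq> (\<lambda>r. l r + unit_vec k r)" "i \<noteq> (\<lambda>r. l r - unit_vec k r)"
      by (auto simp: unit_vec_def)
    then show ?thesis using off unfolding refresh_def by auto
  qed
  then show ?thesis using False unfolding cube_matrix_def by simp
qed

text \<open>The points of the cube that agree with \<open>i\<close> off coordinate \<open>k\<close> form a pair, so every sum against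
  \<open>refresh k\<close> has two terms.\<close>

lemma sum_over_fibre:
  assumes i: "i \<in> cube d" and k: "k \<in> {1..d}"
  shows "(\<Sum>l\<in>cube d. g l * of_bool (\<forall>r. r \<noteq> k \<longrightarrow> l r = i r))
    = (g (i(k := 0)) + g (i(k := 1)) :: real)"
proof -
  have "(\<Sum>l\<in>cube d. g l * of_bool (\<forall>r. r \<noteq> k \<longrightarrow> l r = i r))
      = (\<Sum>l\<in>{i(k := 0), i(k := 1)}. g l)"
  proof (intro sum.mono_neutral_cong_right finite_cube ballI)
    show "{i(k := 0), i(k := 1)} \<subseteq> cube d" using cube_upd[OF i k] by auto
    fix l assume l: "l \<in> cube d - {i(k := 0), i(k := 1)}"
    then have "l k = 0 \<or> l k = 1" using k by (auto simp: cube_def)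
    moreover have "l = i(k := l k)" if "\<forall>r. r \<noteq> k \<longrightarrow> l r = i r"
      using that by auto
    ultimately have "\<not> (\<forall>r. r \<noteq> k \<longrightarrow> l r = i r)" using l by (metis DiffE insertCI)
    then show "g l * of_bool (\<forall>r. r \<noteq> k \<longrightarrow> l r = i r) = 0" by simp
  qed auto
  moreover have "i(k := 0) \<noteq> i(k := 1)" by (metis fun_upd_same zero_neq_one)
  ultimately show ?thesis by simp
qed

lemma sum_refresh:
  assumes "l \<in> cube d" "k \<in> {1..d}"
  shows "(\<Sum>i\<in>cube d. refresh k l i) = 1"
proof -
  have "(\<Sum>i\<in>cube d. refresh k l i)
      = (\<Sum>i\<in>cube d. marginal k (i k) * of_bool (\<forall>r. r \<noteq> k \<longrightarrow> i r = l r))"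
    unfolding refresh_def by (intro sum.cong refl) (metis (full_types))
  also have "\<dots> = 1"
    unfolding sum_over_fibre[OF assms] by (simp add: marginal_def)
  finally show ?thesis .
qed

text \<open>Summing over the old value of coordinate \<open>k\<close> integrates out its factor in the product, which is
  then replaced by the stationary marginal, whether or not \<open>k\<close> had been refreshed before.\<close>

lemma law_refresh:
  assumes i: "i \<in> cube d" and k: "k \<in> {1..d}" and j: "j \<in> cube d"
  shows "(\<Sum>l\<in>cube d. law j S l * refresh k l i) = law j (insert k S) i"
proof -
  define R where "R = (\<Prod>r\<in>{1..d} - {k}. if r \<in> S then marginal r (i r) else of_bool (i r = j r))"
  have split: "law j S (i(k := v)) = (if k \<in> S then marginal k v else of_bool (v = j k)) * R" for v
  proof -
    have "law j S (i(k := v)) = (if k \<in> S then marginal k v else of_bool (v = j k)) *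
        (\<Prod>r\<in>{1..d} - {k}. if r \<in> S then marginal r ((i(k := v)) r) else of_bool ((i(k := v)) r = j r))"
      unfolding law_def using k by (subst prod.remove[of _ k]) auto
    also have "(\<Prod>r\<in>{1..d} - {k}. if r \<in> S then marginal r ((i(k := v)) r)
        else of_bool ((i(k := v)) r = j r)) = R"
      unfolding R_def by (intro prod.cong) auto
    finally show ?thesis .
  qed
  have "j k = 0 \<or> j k = 1" using j k by (auto simp: cube_def)
  then have one: "law j S (i(k := 0)) + law j S (i(k := 1)) = R"
    unfolding split by (auto simp: marginal_def algebra_simps)
  have "(\<Sum>l\<in>cube d. law j S l * refresh k l i)
      = (\<Sum>l\<in>cube d. law j S l * of_bool (\<forall>r. r \<noteq> k \<longrightarrow> l r = i r)) * marginal k (i k)"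
    unfolding refresh_def sum_distrib_right by (simp add: ac_simps)
  also have "\<dots> = R * marginal k (i k)"
    unfolding sum_over_fibre[OF i k] one ..
  also have "\<dots> = marginal k (i k) *
      (\<Prod>r\<in>{1..d} - {k}. if r \<in> insert k S then marginal r (i r) else of_bool (i r = j r))"
    unfolding R_def by (subst mult.commute) (intro arg_cong2[where f = "(*)"] prod.cong; auto)
  also have "\<dots> = law j (insert k S) i"
    unfolding law_def using k by (subst prod.remove[of _ k]) auto
  finally show ?thesis .
qed

text \<open>A step of the walk intertwines with drawing one coupon.\<close>

lemma law_step:
  assumes i: "i \<in> cube d" and j: "j \<in> cube d"
  shows "(\<Sum>l\<in>cube d. law j S l * P l i) = draw (\<lambda>S. law j S i) S"
proof -
  have "(\<Sum>l\<in>cube d. law j S l * P l i)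
      = (\<Sum>l\<in>cube d. \<Sum>k=1..d. p k * (law j S l * refresh k l i))"
    by (intro sum.cong refl) (simp add: cube_matrix_eq_refresh i sum_distrib_left mult.left_commute)
  also have "\<dots> = (\<Sum>k=1..d. p k * (\<Sum>l\<in>cube d. law j S l * refresh k l i))"
    unfolding sum_distrib_left by (rule sum.swap)
  also have "\<dots> = draw (\<lambda>S. law j S i) S"
    unfolding draw_def by (intro sum.cong refl) (simp add: law_refresh i j)
  finally show ?thesis .
qed

lemma law_empty:
  assumes "i \<in> cube d" "j \<in> cube d"
  shows "law j {} i = of_bool (i = j)"
proof (cases "i = j")
  case False
  then obtain k where "i k \<noteq> j k" by auto
  then have "k \<in> {1..d}" using assms unfolding cube_def by (cases "k \<in> {1..d}") auto
  then show ?thesis using False \<open>i k \<noteq> j k\<close> unfolding law_def by (auto intro!: prod_zero)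
qed (simp add: law_def)

text \<open>The law is reached from the point mass at \<open>j\<close> by refreshing the elements of \<open>S\<close> one by one, and
  refreshing preserves total mass.\<close>

lemma sum_law:
  assumes j: "j \<in> cube d" and "finite S" "S \<subseteq> {1..d}"
  shows "(\<Sum>i\<in>cube d. law j S i) = 1"
  using assms(2,3)
proof (induction S)
  case empty
  have "(\<Sum>i\<in>cube d. law j {} i) = (\<Sum>i\<in>cube d. of_bool (i = j))"
    by (intro sum.cong refl) (simp add: law_empty j)
  also have "\<dots> = 1" using j finite_cube by (simp add: of_bool_def)
  finally show ?case .
next
  case (insert k S)
  then have "(\<Sum>i\<in>cube d. law j (insert k S) i) = (\<Sum>i\<in>cube d. \<Sum>l\<in>cube d. law j S l * refresh k l i)"
    by (intro sum.cong refl) (simp add: law_refresh j)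
  also have "\<dots> = (\<Sum>l\<in>cube d. law j S l * (\<Sum>i\<in>cube d. refresh k l i))"
    unfolding sum_distrib_left by (rule sum.swap)
  also have "\<dots> = 1" using insert by (simp add: sum_refresh)
  finally show ?case .
qed

lemma prob_dist_product: "prob_dist (cube d) \<pi>"
proof -
  have "(\<Sum>i\<in>cube d. \<pi> i) = 1"
    using sum_law[OF zero_in_cube, of "{1..d}"] law_full[of "{1..d}" "\<lambda>_. 0"] by simp
  then show ?thesis
    unfolding prob_dist_def using product_dist_pos by (blast intro: less_imp_le)
qed

text \<open>The product distribution is the law for a full set \<open>S\<close>, and a full set stays full.\<close>

lemma product_stationary:
  assumes i: "i \<in> cube d"
  shows "vec_mat (cube d) \<pi> P i = \<pi> i"
proof -
  have "vec_mat (cube d) \<pi> P i = (\<Sum>l\<in>cube d. law (\<lambda>_. 0) {1..d} l * P l i)"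
    unfolding vec_mat_def law_full[OF subset_refl] ..
  also have "\<dots> = (\<Sum>k=1..d. p k * law (\<lambda>_. 0) (insert k {1..d}) i)"
    unfolding law_step[OF i zero_in_cube] draw_def ..
  also have "\<dots> = (\<Sum>k=1..d. p k) * \<pi> i"
    unfolding sum_distrib_right by (intro sum.cong refl) (simp only: law_full[OF subset_insertI])
  finally show ?thesis unfolding sum_p by simp
qed

lemma stochastic: "stochastic_matrix (cube d) P"
  unfolding stochastic_matrix_def prob_dist_def
proof (intro ballI conjI)
  fix l i assume l: "l \<in> cube d" and i: "i \<in> cube d"
  show "0 \<le> P l i"
    unfolding cube_matrix_eq_refresh[OF l i] refresh_def
    using p_pos by (intro sum_nonneg mult_nonneg_nonneg) (auto intro: marginal_nonneg less_imp_le)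
next
  fix l assume l: "l \<in> cube d"
  have "(\<Sum>i\<in>cube d. P l i) = (\<Sum>i\<in>cube d. \<Sum>k=1..d. p k * refresh k l i)"
    by (intro sum.cong refl) (simp add: cube_matrix_eq_refresh l)
  also have "\<dots> = (\<Sum>k=1..d. p k * (\<Sum>i\<in>cube d. refresh k l i))"
    unfolding sum_distrib_left by (rule sum.swap)
  also have "\<dots> = 1" using sum_p by (simp add: sum_refresh l)
  finally show "(\<Sum>i\<in>cube d. P l i) = 1" .
qed

lemma mat_pow_eq_expect:
  assumes j: "j \<in> cube d"
  shows "i \<in> cube d \<Longrightarrow> mat_pow (cube d) P t j i = expect t (\<lambda>S. law j S i)"
proof (induction t arbitrary: i)
  case 0
  then show ?case unfolding expect_0 law_empty[OF 0 j] by auto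
next
  case (Suc t)
  have "mat_pow (cube d) P (Suc t) j i = (\<Sum>l\<in>cube d. expect t (\<lambda>S. law j S l) * P l i)"
    using Suc.IH by simp
  also have "\<dots> = expect t (\<lambda>S. \<Sum>l\<in>cube d. law j S l * P l i)"
    by (simp only: expect_sum expect_mult_right)
  also have "\<dots> = expect (Suc t) (\<lambda>S. law j S i)"
    unfolding expect_Suc using law_step[OF Suc.prems j] by simp
  finally show ?case .
qed

text \<open>On the event that every coordinate has been refreshed the walk is stationary, whatever its start.\<close>

lemma mat_pow_ge:
  assumes "j \<in> cube d" "i \<in> cube d"
  shows "collection_prob t * \<pi> i \<le> mat_pow (cube d) P t j i"
proof -
  have "of_bool ({1..d} \<subseteq> S) * \<pi> i \<le> law j S i" for S
    using law_full[of S j i] law_nonneg[of j S i] by (cases "{1..d} \<subseteq> S") auto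
  then show ?thesis
    unfolding mat_pow_eq_expect[OF assms] collection_prob_def
    by (subst expect_mult_right[symmetric]) (rule expect_mono)
qed

lemma eventually_mat_pow_pos:
  assumes j: "j \<in> cube d" and i: "i \<in> cube d"
  shows "eventually (\<lambda>t. 0 < mat_pow (cube d) P t j i) sequentially"
proof -
  have "eventually (\<lambda>t. 0 < collection_prob t) sequentially"
    using eventually_collected[of 1] by simp
  then show ?thesis
    by eventually_elim (rule less_le_trans[OF mult_pos_pos[OF _ product_dist_pos[OF i]] mat_pow_ge[OF j i]])
qed

lemma ergodic: "ergodic_chain (cube d) delta_zero P"
proof -
  have "prob_dist (cube d) delta_zero"
    using zero_in_cube finite_cube by (auto simp: prob_dist_def delta_zero_def)
  moreover have "irreducible_matrix (cube d) P"
    unfolding irreducible_matrix_def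
    using eventually_happens'[OF sequentially_bot eventually_mat_pow_pos] by blast
  moreover have "aperiodic_matrix (cube d) P"
    unfolding aperiodic_matrix_def
  proof
    fix i assume i: "i \<in> cube d"
    let ?G = "{n. 0 < n \<and> 0 < mat_pow (cube d) P n i i}"
    obtain N where N: "\<And>t. t \<ge> N \<Longrightarrow> 0 < mat_pow (cube d) P t i i"
      using eventually_mat_pow_pos[OF i i] by (auto simp: eventually_sequentially)
    have "Suc N \<in> ?G" "Suc (Suc N) \<in> ?G" using N by (auto simp del: mat_pow.simps)
    then have "Gcd ?G dvd Suc N" "Gcd ?G dvd Suc (Suc N)" by (auto simp del: mat_pow.simps intro!: Gcd_dvd)
    then have "Gcd ?G dvd Suc (Suc N) - Suc N" by (rule dvd_diff_nat[rotated])
    then show "Gcd ?G = 1" by simp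
  qed
  ultimately show ?thesis
    using stochastic finite_cube zero_in_cube by (auto simp: ergodic_chain_def)
qed

lemma stationary_mat_pow:
  assumes "\<forall>j\<in>cube d. vec_mat (cube d) \<mu> P j = \<mu> j" "i \<in> cube d"
  shows "(\<Sum>j\<in>cube d. \<mu> j * mat_pow (cube d) P t j i) = \<mu> i"
  using assms(2)
proof (induction t arbitrary: i)
  case 0
  have "(\<Sum>j\<in>cube d. \<mu> j * mat_pow (cube d) P 0 j i) = (\<Sum>j\<in>cube d. if j = i then \<mu> j else 0)"
    by (intro sum.cong) auto
  then show ?case using 0 finite_cube by (simp del: mat_pow.simps)
next
  case (Suc t)
  have "(\<Sum>j\<in>cube d. \<mu> j * mat_pow (cube d) P (Suc t) j i)
      = (\<Sum>j\<in>cube d. \<Sum>l\<in>cube d. \<mu> j * mat_pow (cube d) P t j l * P l i)"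
    by (simp only: mat_pow.simps sum_distrib_left mult.assoc)
  also have "\<dots> = (\<Sum>l\<in>cube d. (\<Sum>j\<in>cube d. \<mu> j * mat_pow (cube d) P t j l) * P l i)"
    unfolding sum_distrib_right by (rule sum.swap)
  also have "\<dots> = \<mu> i"
    using assms(1) Suc.prems by (simp add: vec_mat_def Suc.IH cong: sum.cong)
  finally show ?case .
qed

text \<open>For uniqueness, average \<open>mat_pow_ge\<close> over a stationary start \<open>\<mu>\<close> and let the number of steps grow:
  this gives \<open>\<pi> \<le> \<mu>\<close> pointwise, hence equality, as both have total mass \<open>1\<close>.\<close>

lemma stationary_iff: "stationary_dist (cube d) P \<mu> \<longleftrightarrow> (\<forall>i\<in>cube d. \<mu> i = \<pi> i)"
proof
  assume eq: "\<forall>i\<in>cube d. \<mu> i = \<pi> i"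
  have "prob_dist (cube d) \<mu>"
    using prob_dist_product eq unfolding prob_dist_def by (simp cong: sum.cong)
  moreover have "vec_mat (cube d) \<mu> P i = \<mu> i" if "i \<in> cube d" for i
    using product_stationary[OF that] eq that by (simp add: vec_mat_def cong: sum.cong)
  ultimately show "stationary_dist (cube d) P \<mu>" by (simp add: stationary_dist_def)
next
  assume st: "stationary_dist (cube d) P \<mu>"
  have \<mu>_sum: "(\<Sum>i\<in>cube d. \<mu> i) = 1" and \<mu>_nonneg: "\<And>i. i \<in> cube d \<Longrightarrow> 0 \<le> \<mu> i"
    using st by (auto simp: stationary_dist_def prob_dist_def)
  have le: "\<pi> i \<le> \<mu> i" if i: "i \<in> cube d" for i
  proof (rule field_le_epsilon)
    fix e :: real assume "0 < e"
    have pos: "0 < \<pi> i" by (rule product_dist_pos[OF i])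
    obtain t where t: "1 - e / \<pi> i < collection_prob t"
      using eventually_happens'[OF sequentially_bot eventually_collected[of "e / \<pi> i"]] \<open>0 < e\<close> pos by auto
    have "collection_prob t * \<pi> i = (\<Sum>j\<in>cube d. \<mu> j * (collection_prob t * \<pi> i))"
      unfolding sum_distrib_right[symmetric] \<mu>_sum by simp
    also have "\<dots> \<le> (\<Sum>j\<in>cube d. \<mu> j * mat_pow (cube d) P t j i)"
      using mat_pow_ge i \<mu>_nonneg by (intro sum_mono mult_left_mono) auto
    also have "\<dots> = \<mu> i"
      using stationary_mat_pow[OF _ i] st by (auto simp: stationary_dist_def)
    finally have "collection_prob t * \<pi> i \<le> \<mu> i" .
    moreover have "(1 - e / \<pi> i) * \<pi> i \<le> collection_prob t * \<pi> i"
      using t pos by (intro mult_right_mono) auto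
    ultimately show "\<pi> i \<le> \<mu> i + e" using pos by (simp add: algebra_simps)
  qed
  have "(\<Sum>i\<in>cube d. \<mu> i - \<pi> i) = 0"
    using \<mu>_sum prob_dist_product by (simp add: sum_subtractf prob_dist_def)
  then show "\<forall>i\<in>cube d. \<mu> i = \<pi> i"
    using le finite_cube by (subst (asm) sum_nonneg_eq_0_iff) auto
qed

text \<open>The lower bound \<open>mat_pow_ge\<close> is attained at \<open>(1,\<dots>,1)\<close>: that state has conditional probability
  \<open>0\<close> as long as some coordinate still has its initial value \<open>0\<close>.\<close>

lemma sep_eq_incomplete:
  "sep_at (cube d) delta_zero P \<pi> x = 1 - collection_prob (nat \<lfloor>x\<rfloor>)"
proof -
  define t where "t = nat \<lfloor>x\<rfloor>"
  let ?one = "\<lambda>k. if k \<in> {1..d} then 1 else (0::int)"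
  have start: "vec_mat (cube d) delta_zero (mat_pow (cube d) P t) i = mat_pow (cube d) P t (\<lambda>_. 0) i" for i
    unfolding vec_mat_def delta_zero_def using finite_cube zero_in_cube
    by (simp add: if_distrib[of "\<lambda>u. u * _"] cong: if_cong)
  have one: "?one \<in> cube d" by (simp add: cube_def)
  have law_one: "law (\<lambda>_. 0) S ?one = of_bool ({1..d} \<subseteq> S) * \<pi> ?one" for S
  proof (cases "{1..d} \<subseteq> S")
    case True
    then show ?thesis using law_full[OF True] by simp
  next
    case False
    then show ?thesis unfolding law_def by (auto intro!: prod_zero)
  qed
  have top: "mat_pow (cube d) P t (\<lambda>_. 0) ?one = collection_prob t * \<pi> ?one"
    unfolding mat_pow_eq_expect[OF zero_in_cube one] collection_prob_def
    by (simp only: law_one expect_mult_right)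
  have "sep (cube d) (vec_mat (cube d) delta_zero (mat_pow (cube d) P t)) \<pi> = 1 - collection_prob t"
    unfolding sep_def start
  proof (rule Max_eqI)
    show "finite ((\<lambda>e. 1 - mat_pow (cube d) P t (\<lambda>_. 0) e / \<pi> e) ` cube d)"
      using finite_cube by simp
    show "1 - collection_prob t \<in> (\<lambda>e. 1 - mat_pow (cube d) P t (\<lambda>_. 0) e / \<pi> e) ` cube d"
      using one product_dist_pos[OF one] top by (intro image_eqI[of _ _ ?one]) auto
    fix y assume "y \<in> (\<lambda>e. 1 - mat_pow (cube d) P t (\<lambda>_. 0) e / \<pi> e) ` cube d"
    then show "y \<le> 1 - collection_prob t"
      using mat_pow_ge[OF zero_in_cube] product_dist_pos by (auto simp: field_simps)
  qed
  then show ?thesis by (simp add: sep_at_def t_def)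
qed

end

section \<open>Both sides of the cutoff window\<close>

context refreshment
begin

text \<open>With \<open>q = L / d\<close>, the union bound \<open>d exp (q (1 - x))\<close> at \<open>x = (d / L)(ln d - ln b + c)\<close> equals
  \<open>b exp (L / d) exp (- c)\<close>.\<close>

lemma sep_after_cutoff:
  assumes d: "1 \<le> d" and L: "0 < L" "\<And>k. k \<in> {1..d} \<Longrightarrow> L / real d \<le> p k" and b: "0 < b"
  shows "sep_at (cube d) delta_zero P \<pi> (real d / L * (ln (real d) - ln b) + c * (real d / L))
    \<le> b * exp L * exp (- c)"
    (is "sep_at _ _ _ _ ?x \<le> _")
proof -
  have "1 - collection_prob (nat \<lfloor>?x\<rfloor>) \<le> real (card {1..d}) * exp (L / real d * (1 - ?x))"
    using L d by (intro incomplete_le_exp) auto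
  also have "L / real d * (1 - ?x) = L / real d - ln (real d) + ln b - c"
    using L d by (simp add: field_simps)
  also have "real (card {1..d}) * exp (L / real d - ln (real d) + ln b - c) = b * exp (L / real d) * exp (- c)"
  proof -
    have e: "exp (L / real d - ln (real d) + ln b - c) = exp (L / real d) / real d * b / exp c"
      unfolding exp_diff exp_add using d b by simp
    then show ?thesis unfolding e using d by (simp add: exp_minus divide_simps)
  qed
  also have "\<dots> \<le> b * exp L * exp (- c)"
    using d b L by (simp add: field_simps)
  finally show ?thesis by (simp add: sep_eq_incomplete)
qed

text \<open>The second moment method is applied to the first \<open>\<lfloor>b d\<rfloor>\<close> coordinates, whose cells lie in the
  region \<open>[0, b]\<close>. The last two conditions on \<open>d\<close> make the time nonnegative and keep the second-order
  term of the exponent below \<open>1\<close>; together with \<open>\<lfloor>b d\<rfloor> \<ge> b d / 2\<close> this costs the factor \<open>2 exp 1\<close>.\<close>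

lemma sep_before_cutoff:
  assumes L: "0 < L" "\<And>k. k \<in> {1..d} \<Longrightarrow> real k / real d \<le> b \<Longrightarrow> p k = L / real d"
    and b: "0 < b" "b \<le> 1"
    and large: "L / real d \<le> 1 / 2" "2 \<le> b * real d"
      "0 \<le> ln (real d) - ln b - c" "2 * (L / real d) * (ln (real d) - ln b - c) \<le> 1"
  shows "1 - 2 * exp (1 - c) / b\<^sup>2
    \<le> sep_at (cube d) delta_zero P \<pi> (real d / L * (ln (real d) - ln b) - c * (real d / L))"
    (is "_ \<le> sep_at _ _ _ _ ?x")
proof -
  define q where "q = L / real d"
  define l where "l = ln (real d) - ln b - c"
  define N where "N = nat \<lfloor>b * real d\<rfloor>"
  have d: "0 < real d" using large(2) b by (cases "d = 0") auto
  have N_le: "real N \<le> b * real d" using b by (simp add: N_def)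
  have N_ge: "b * real d / 2 \<le> real N" using large(2) unfolding N_def by linarith
  have "b * real d \<le> real d" using b by (simp add: mult_left_le_one_le)
  then have "N \<le> d" using N_le by linarith
  have x: "?x = real d / L * l" using L(1) by (simp add: l_def field_simps)
  have "collection_prob (nat \<lfloor>?x\<rfloor>) \<le> exp ((q + 2 * q\<^sup>2) * ?x) / real (card {1..N})"
  proof (rule collection_prob_le_exp)
    show "{1..N} \<subseteq> {1..d}" using \<open>N \<le> d\<close> by auto
    show "{1..N} \<noteq> {}" using N_ge large(2) by (cases "N = 0") auto
    show "p k = q" if "k \<in> {1..N}" for k
    proof -
      have "real k \<le> real N" using that by simp
      then have "real k \<le> b * real d" using N_le by linarith
      then show ?thesis using L(2)[of k] that \<open>N \<le> d\<close> d by (simp add: q_def field_simps)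
    qed
    show "0 \<le> q" "q \<le> 1 / 2" using L(1) large(1) by (auto simp: q_def)
    show "0 \<le> ?x" unfolding x using L(1) large(3) by (simp add: l_def)
  qed
  also have "(q + 2 * q\<^sup>2) * ?x = l + 2 * q * l"
    unfolding x using L(1) d by (simp add: q_def field_simps power2_eq_square)
  also have "exp (l + 2 * q * l) / real (card {1..N}) \<le> exp (l + 1) / (b * real d / 2)"
    using large(4) N_ge b d by (intro frac_le) (auto simp: q_def l_def)
  also have "exp (l + 1) = real d / b * exp (1 - c)"
    using d b by (simp add: l_def exp_diff exp_add field_simps)
  also have "real d / b * exp (1 - c) / (b * real d / 2) = 2 * exp (1 - c) / b\<^sup>2"
    using d b by (simp add: field_simps power2_eq_square)
  finally show ?thesis by (simp add: sep_eq_incomplete)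
qed

lemma sep_bounds: "0 \<le> sep_at (cube d) delta_zero P \<pi> x" "sep_at (cube d) delta_zero P \<pi> x \<le> 1"
proof -
  show "sep_at (cube d) delta_zero P \<pi> x \<le> 1"
    using collection_prob_nonneg by (simp add: sep_eq_incomplete)
  have "collection_prob t \<le> 1" for t
  proof -
    have "collection_prob t \<le> expect t (\<lambda>_. 1)" unfolding collection_prob_def by (rule expect_mono) simp
    then show ?thesis unfolding expect_const .
  qed
  then show "0 \<le> sep_at (cube d) delta_zero P \<pi> x" by (simp add: sep_eq_incomplete)
qed

end

section \<open>Cell masses of a density\<close>

lemma cell_mass_sum:
  assumes f: "f integrable_on {0..1}" and d: "1 \<le> d"
  shows "N \<le> d \<Longrightarrow> (\<Sum>k=1..N. cell_mass f d k) = integral {0..real N / real d} f"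
proof (induction N)
  case (Suc N)
  have "f integrable_on {0..real (Suc N) / real d}"
    using Suc.prems d by (intro integrable_on_subinterval[OF f]) (auto simp: field_simps)
  then have "integral {0..real N / real d} f + integral {real N / real d..real (Suc N) / real d} f
      = integral {0..real (Suc N) / real d} f"
    using d by (intro Henstock_Kurzweil_Integration.integral_combine) (auto simp: divide_right_mono)
  then show ?case using Suc by (simp add: cell_mass_def)
qed simp

lemma cell_subset:
  assumes "k \<in> {1..d}"
  shows "{(real k - 1) / real d..real k / real d} \<subseteq> {0..1}"
proof -
  have "0 \<le> (real k - 1) / real d" "real k / real d \<le> 1" using assms by auto
  then show ?thesis by auto
qed

lemma cell_length: "1 \<le> d \<Longrightarrow> real k / real d - (real k - 1) / real d = 1 / real d"
  by (simp add: field_simps)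

text \<open>The value at \<open>0\<close>, which may be smaller than \<open>c\<close>, is replaced by \<open>c\<close> without changing the integral.\<close>

lemma cell_mass_ge:
  assumes f: "f integrable_on {0..1}" and k: "k \<in> {1..d}"
    and c: "\<And>y. 0 < y \<Longrightarrow> y \<le> 1 \<Longrightarrow> c \<le> f y"
  shows "c / real d \<le> cell_mass f d k"
proof -
  let ?I = "{(real k - 1) / real d..real k / real d}"
  have "(f has_integral cell_mass f d k) ?I"
    unfolding cell_mass_def using integrable_on_subinterval[OF f cell_subset[OF k]] by blast
  then have mass: "((\<lambda>y. if y = 0 then c else f y) has_integral cell_mass f d k) ?I"
    by (rule has_integral_spike_finite[of "{0}", rotated 2]) auto
  have const: "((\<lambda>_. c) has_integral c / real d) ?I"
    using has_integral_const_real[of c "(real k - 1) / real d" "real k / real d"] k cell_length[of d k]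
    by (simp add: divide_right_mono)
  have "c \<le> (if y = 0 then c else f y)" if "y \<in> ?I" for y
  proof (cases "y = 0")
    case False
    have "y \<in> {0..1}" using that cell_subset[OF k] by blast
    then show ?thesis using False c[of y] by simp
  qed simp
  then show ?thesis by (rule has_integral_le[OF const mass])
qed

lemma cell_mass_eq:
  assumes k: "k \<in> {1..d}" and c: "\<And>y. 0 < y \<Longrightarrow> y \<le> b \<Longrightarrow> f y = c" and b: "real k / real d \<le> b"
  shows "cell_mass f d k = c / real d"
proof -
  let ?I = "{(real k - 1) / real d..real k / real d}"
  have const: "((\<lambda>_. c) has_integral c / real d) ?I"
    using has_integral_const_real[of c "(real k - 1) / real d" "real k / real d"] k cell_length[of d k]
    by (simp add: divide_right_mono)
  have "f y = c" if "y \<in> ?I - {0}" for y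
  proof (rule c)
    have "y \<in> {0..1}" using that cell_subset[OF k] by blast
    then show "0 < y" using that by auto
    show "y \<le> b" using that b by auto
  qed
  then have "(f has_integral c / real d) ?I"
    by (rule has_integral_spike_finite[OF _ _ const, rotated]) auto
  then show ?thesis unfolding cell_mass_def by (rule integral_unique)
qed

section \<open>The cutoff\<close>

lemma step_mono:
  fixes g :: "nat \<Rightarrow> real"
  assumes "\<And>j. i \<le> j \<Longrightarrow> j < m \<Longrightarrow> g j < g (Suc j)" and "i \<le> j" "j \<le> m"
  shows "g i \<le> g j"
  using assms(2,3)
proof (induction j rule: dec_induct)
  case (step j)
  then show ?case using assms(1)[of j] by simp
qed simp

lemma step_density_ge:
  fixes f :: "real \<Rightarrow> real" and lam n :: "nat \<Rightarrow> real"
  assumes "n 0 = 0" "n m = 1" "\<forall>j\<in>{1..<m}. lam j < lam (j + 1)"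
    and f: "\<forall>j\<in>{1..m}. \<forall>y. n (j - 1) < y \<and> y \<le> n j \<longrightarrow> f y = lam j"
    and y: "0 < y" "y \<le> 1"
  shows "lam 1 \<le> f y"
proof -
  \<comment> \<open>The least such index belongs to the piece that contains \<open>y\<close>.\<close>
  define j where "j = (LEAST j. y \<le> n j)"
  have "y \<le> n m" using y assms by simp
  then have j: "y \<le> n j" "j \<le> m" unfolding j_def by (rule LeastI, rule Least_le)
  have "j \<noteq> 0" using j y assms by (auto intro: ccontr)
  then have "\<not> y \<le> n (j - 1)" unfolding j_def by (intro not_less_Least) (simp add: j_def[symmetric])
  then have "f y = lam j" using f j \<open>j \<noteq> 0\<close> by auto
  moreover have "lam 1 \<le> lam j"
    using assms(3) j \<open>j \<noteq> 0\<close> by (intro step_mono[of 1 m]) auto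
  ultimately show ?thesis by simp
qed

theorem corollary4p13:
  fixes f :: "real \<Rightarrow> real" and m :: nat and lam n :: "nat \<Rightarrow> real"
    and a :: "nat \<Rightarrow> nat \<Rightarrow> real"
  assumes "1 \<le> m"
    and "n 0 = 0" and "n m = 1" and "\<forall>j\<in>{1..m}. n (j - 1) < n j"
    and "\<forall>j\<in>{1..m}. 0 < lam j" and "\<forall>j\<in>{1..<m}. lam j < lam (j + 1)"
    and "density_on {0..1} f"
    and "\<forall>j\<in>{1..m}. \<forall>y. n (j - 1) < y \<and> y \<le> n j \<longrightarrow> f y = lam j"
    and "\<forall>d\<ge>1. \<forall>k\<in>{1..d}. 0 < a d k \<and> a d k < 1"
  shows "(\<forall>d\<ge>1. \<forall>\<mu>. stationary_dist (cube d) (cube_matrix d (a d) (cell_mass f d)) \<mu> \<longleftrightarrow>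
            (\<forall>i\<in>cube d. \<mu> i = cube_product_dist d (a d) i)) \<and>
         separation_cutoff cube (\<lambda>d. delta_zero)
           (\<lambda>d. cube_matrix d (a d) (cell_mass f d))
           (\<lambda>d. cube_product_dist d (a d))
           (\<lambda>d. real d / lam 1 * (ln (real d) - ln (n 1)))
           (\<lambda>d. real d / lam 1)"
proof -
  define L where "L = lam 1"
  define b where "b = n 1"
  have L: "0 < L" using assms(1,5) by (simp add: L_def)
  have b0: "0 < b" using assms(1,2,4) by (force simp: b_def)
  have b1: "b \<le> 1"
    unfolding b_def assms(3)[symmetric] using assms(1,4) by (intro step_mono[of 1 m]) force+
  have int: "f integrable_on {0..1}" and int1: "integral {0..1} f = 1"
    using assms(7) by (auto simp: density_on_def)
  have f_ge: "L \<le> f y" if "0 < y" "y \<le> 1" for y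
    unfolding L_def using step_density_ge[OF assms(2,3,6,8) that] .
  have f_eq: "f y = L" if "0 < y" "y \<le> b" for y
    using assms(1,2,8) that by (force simp: L_def b_def)
  have mass_ge: "L / real d \<le> cell_mass f d k" if "k \<in> {1..d}" for d k
    using cell_mass_ge[OF int that] f_ge by blast
  have mass_eq: "cell_mass f d k = L / real d" if "k \<in> {1..d}" "real k / real d \<le> b" for d k
    using cell_mass_eq[OF that(1) _ that(2)] f_eq by blast
  have walk: "refreshment d (cell_mass f d) (a d)" if d: "1 \<le> d" for d
  proof
    show "0 < cell_mass f d k" if "k \<in> {1..d}" for k
      using mass_ge[OF that] L d by (auto intro: less_le_trans[rotated])
    show "sum (cell_mass f d) {1..d} = 1" using cell_mass_sum[OF int d order_refl] int1 d by simp
    show "0 < a d k \<and> a d k < 1" if "k \<in> {1..d}" for k using assms(9) d that by blast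
  qed simp
  let ?P = "\<lambda>d. cube_matrix d (a d) (cell_mass f d)"
  let ?\<pi> = "\<lambda>d. cube_product_dist d (a d)"
  let ?t = "\<lambda>d::nat. real d / L * (ln (real d) - ln b)"
  let ?w = "\<lambda>d::nat. real d / L"
  let ?s = "\<lambda>d x. ereal (sep_at (cube d) delta_zero (?P d) (?\<pi> d) x)"
  have stat: "stationary_dist (cube d) (?P d) \<mu> \<longleftrightarrow> (\<forall>i\<in>cube d. \<mu> i = ?\<pi> d i)" if "1 \<le> d" for d \<mu>
    by (rule refreshment.stationary_iff[OF walk[OF that]])
  have window: "?w \<in> o(?t)" using L by real_asymp
  have after: "((\<lambda>c. limsup (\<lambda>d. ?s d (?t d + c * ?w d))) \<longlongrightarrow> 0) at_top"
  proof (rule tendsto_sandwich)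
    have "0 \<le> limsup (\<lambda>d. ?s d (?t d + c * ?w d))" for c
    proof -
      have "eventually (\<lambda>d. 0 \<le> ?s d (?t d + c * ?w d)) sequentially"
        using eventually_ge_at_top[of 1]
        by eventually_elim (simp add: refreshment.sep_bounds(1)[OF walk])
      then have "0 \<le> liminf (\<lambda>d. ?s d (?t d + c * ?w d))" by (rule Liminf_bounded)
      also have "\<dots> \<le> limsup (\<lambda>d. ?s d (?t d + c * ?w d))" by (rule Liminf_le_Limsup) simp
      finally show ?thesis .
    qed
    then show "eventually (\<lambda>c. 0 \<le> limsup (\<lambda>d. ?s d (?t d + c * ?w d))) at_top" by simp
    have "limsup (\<lambda>d. ?s d (?t d + c * ?w d)) \<le> ereal (b * exp L * exp (- c))" for c
    proof (rule Limsup_bounded)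
      show "eventually (\<lambda>d. ?s d (?t d + c * ?w d) \<le> ereal (b * exp L * exp (- c))) sequentially"
        using eventually_ge_at_top[of 1]
      proof eventually_elim
        case (elim d)
        show ?case
          unfolding ereal_less_eq
          by (rule refreshment.sep_after_cutoff[OF walk[OF elim] elim L mass_ge b0])
      qed
    qed
    then show "eventually (\<lambda>c. limsup (\<lambda>d. ?s d (?t d + c * ?w d)) \<le> ereal (b * exp L * exp (- c))) at_top"
      by simp
    have "((\<lambda>c. b * exp L * exp (- c)) \<longlongrightarrow> 0) at_top" using b0 by real_asymp
    then show "((\<lambda>c. ereal (b * exp L * exp (- c))) \<longlongrightarrow> 0) at_top"
      by (simp add: zero_ereal_def)
  qed simp
  have before: "((\<lambda>c. liminf (\<lambda>d. ?s d (?t d - c * ?w d))) \<longlongrightarrow> 1) at_top"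
  proof (rule tendsto_sandwich)
    have "ereal (1 - 2 * exp (1 - c) / b\<^sup>2) \<le> liminf (\<lambda>d. ?s d (?t d - c * ?w d))" for c
    proof (rule Liminf_bounded)
      have "eventually (\<lambda>d::nat. L / real d \<le> 1 / 2) sequentially" using L by real_asymp
      moreover have "eventually (\<lambda>d::nat. 2 \<le> b * real d) sequentially" using b0 by real_asymp
      moreover have "eventually (\<lambda>d::nat. 0 \<le> ln (real d) - ln b - c) sequentially" by real_asymp
      moreover have "eventually (\<lambda>d::nat. 2 * (L / real d) * (ln (real d) - ln b - c) \<le> 1) sequentially"
        using L by real_asymp
      ultimately show "eventually (\<lambda>d. ereal (1 - 2 * exp (1 - c) / b\<^sup>2) \<le> ?s d (?t d - c * ?w d)) sequentially"
        using eventually_ge_at_top[of 1]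
      proof eventually_elim
        case (elim d)
        show ?case
          unfolding ereal_less_eq
          by (rule refreshment.sep_before_cutoff[OF walk[OF elim(5)] L mass_eq b0 b1])
            (use elim in auto)
      qed
    qed
    then show "eventually (\<lambda>c. ereal (1 - 2 * exp (1 - c) / b\<^sup>2) \<le> liminf (\<lambda>d. ?s d (?t d - c * ?w d))) at_top"
      by simp
    have "liminf (\<lambda>d. ?s d (?t d - c * ?w d)) \<le> 1" for c
    proof -
      have "eventually (\<lambda>d. ?s d (?t d - c * ?w d) \<le> 1) sequentially"
        using eventually_ge_at_top[of 1]
        by eventually_elim (simp add: refreshment.sep_bounds(2)[OF walk])
      then have "limsup (\<lambda>d. ?s d (?t d - c * ?w d)) \<le> 1" by (rule Limsup_bounded)
      then show ?thesis by (rule order_trans[OF Liminf_le_Limsup, rotated]) simp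
    qed
    then show "eventually (\<lambda>c. liminf (\<lambda>d. ?s d (?t d - c * ?w d)) \<le> 1) at_top" by simp
    have "((\<lambda>c. 1 - 2 * exp (1 - c) / b\<^sup>2) \<longlongrightarrow> 1) at_top" using b0 by real_asymp
    then show "((\<lambda>c. ereal (1 - 2 * exp (1 - c) / b\<^sup>2)) \<longlongrightarrow> 1) at_top"
      by (simp add: one_ereal_def)
  qed simp
  show ?thesis
    unfolding separation_cutoff_def L_def[symmetric] b_def[symmetric]
    using stat refreshment.ergodic[OF walk] window after before by auto
qed

end
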